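(* Let $G$ be a finite group of order $N$ acting unitarily on the $d$-dimensional real inner product space $\mathcal{V}$. Fix $\mathbf{w}=(w_1,\dots,w_p)\in\mathcal{V}^p$ and $S\subset[N]\times[p]$ with $|S|=m$, and suppose that the map $\widehat{\Phi}_{\mathbf{w},S}:\widehat{\mathcal{V}}\to\mathbb{R}^m$ induced by the coorbit embedding $\Phi_{\mathbf{w},S}$ is injective on the quotient space $\widehat{\mathcal{V}}=\mathcal{V}/G$. Then there exist $0<a\le b<\infty$ such that for all $x,y\in\mathcal{V}$, $$a\,\mathbf{d}([x],[y])\le\|\Phi_{\mathbf{w},S}(x)-\Phi_{\mathbf{w},S}(y)\|_2\le b\,\mathbf{d}([x],[y]).$$
   Context: $(\mathcal{V},\langle\cdot,\cdot\rangle)$ is a real inner product space of finite dimension $d\ge 2$. $G$ is a finite group with $|G|=N$ acting unitarily on $\mathcal{V}$: $g\mapsto U_g$ is a homomorphism into the group of linear isometries of $\mathcal{V}$. The orbit of $x$ is $[x]=\{U_gx: g\in G\}$, $x\sim y$ means $[x]=[y]$, $\widehat{\mathcal{V}}=\mathcal{V}/\sim$ is the set of orbits, with metric $\mathbf{d}([x],[y])=\min_{g\in G}\|x-U_gy\|$. For $n\in\mathbb{N}$, $[n]=\{1,\dots,n\}$. For $i\in[p]$ and $j\in[N]$, $\Phi_{i,j}(x)=\Phi_{w_i,j}(x)$ is the $j$-th coordinate of the vector obtained by sorting the $N$ numbers $(\langle U_gw_i,x\rangle)_{g\in G}$ (with repetitions) in decreasing order. For $S\subset[N]\times[p]$ put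 $S_i=\{k\in[N]:(k,i)\in S\}$, $m_i=|S_i|$ and $m=|S|=\sum_i m_i$. The coorbit embedding is $$\Phi_{\mathbf{w},S}:\mathcal{V}\to\mathbb{R}^m,\qquad \Phi_{\mathbf{w},S}(x)=\big[\{\Phi_{w_1,j}(x)\}_{j\in S_1},\dots,\{\Phi_{w_p,j}(x)\}_{j\in S_p}\big].$$ It is $G$-invariant, and $\widehat{\Phi}_{\mathbf{w},S}([x])=\Phi_{\mathbf{w},S}(x)$ denotes the induced map on $\widehat{\mathcal{V}}$. *)

theory Defs
  imports "HOL-Analysis.Analysis" "HOL-Algebra.Group_Action"
begin

text \<open>
  A finite group acting by linear isometries. \<^term>\<open>group_action G UNIV U\<close> says that
  \<^term>\<open>U\<close> is a homomorphism into the group of all bijections of the space; together with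
  the last assumption it is a homomorphism into the subgroup of linear isometries.
\<close>

locale finite_unitary_action = group_action G UNIV U
  for G (structure) and U :: "'g \<Rightarrow> 'a::euclidean_space \<Rightarrow> 'a" +
  assumes finite_carrier: "finite (carrier G)"
    and isometry: "g \<in> carrier G \<Longrightarrow> orthogonal_transformation (U g)"

text \<open>
  Maps on the quotient \<^term>\<open>orbits G UNIV U\<close> are given by their values on representatives,
  extracted with \<^const>\<open>the_elem\<close>; independence of the representatives is proved below
  (\<open>orbit_dist_orbit\<close>, \<open>coorbit_quot_orbit\<close>).
\<close>

definition orbit_dist ::
    "('g, 'b) monoid_scheme \<Rightarrow> ('g \<Rightarrow> 'a::euclidean_space \<Rightarrow> 'a) \<Rightarrow> 'a set \<Rightarrow> 'a set \<Rightarrow> real" where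
  "orbit_dist G U A B =
     the_elem ((\<lambda>(x, y). Min ((\<lambda>g. norm (x - U g y)) ` carrier G)) ` (A \<times> B))"

text \<open>The index \<^term>\<open>j\<close> is 1-based: \<^term>\<open>j = (1::nat)\<close> gives the largest entry.\<close>

definition coorbit ::
    "('g, 'b) monoid_scheme \<Rightarrow> ('g \<Rightarrow> 'a::euclidean_space \<Rightarrow> 'a) \<Rightarrow> 'a \<Rightarrow> nat \<Rightarrow> 'a \<Rightarrow> real" where
  "coorbit G U w j x =
     rev (sorted_list_of_multiset {#U g w \<bullet> x. g \<in># mset_set (carrier G)#}) ! (j - 1)"

text \<open>
  Vectors of \<open>\<real>\<^sup>m\<close> are lists of length \<open>m\<close>. A pair \<^term>\<open>(k, i) \<in> S\<close> selects the \<open>k\<close>-th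
  coordinate for the window \<^term>\<open>w i\<close>; within the block of \<^term>\<open>w i\<close> the selected
  coordinates appear in increasing order of \<open>k\<close>.
\<close>

definition coorbit_embedding ::
    "('g, 'b) monoid_scheme \<Rightarrow> ('g \<Rightarrow> 'a::euclidean_space \<Rightarrow> 'a) \<Rightarrow> nat \<Rightarrow> (nat \<Rightarrow> 'a) \<Rightarrow> (nat \<times> nat) set
      \<Rightarrow> 'a \<Rightarrow> real list" where
  "coorbit_embedding G U p w S x =
     concat (map (\<lambda>i. map (\<lambda>j. coorbit G U (w i) j x) (sorted_list_of_set {k. (k, i) \<in> S}))
                 [1..<p + 1])"

definition coorbit_quot ::
    "('g, 'b) monoid_scheme \<Rightarrow> ('g \<Rightarrow> 'a::euclidean_space \<Rightarrow> 'a) \<Rightarrow> nat \<Rightarrow> (nat \<Rightarrow> 'a) \<Rightarrow> (nat \<times> nat) set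
      \<Rightarrow> 'a set \<Rightarrow> real list" where
  "coorbit_quot G U p w S A = the_elem (coorbit_embedding G U p w S ` A)"

lemma length_coorbit_embedding:
  assumes "S \<subseteq> {1..N} \<times> {1..p}"
  shows "length (coorbit_embedding G U p w S x) = card S"
proof -
  have fin: "finite {k. (k, i) \<in> S}" for i
    by (rule finite_subset[of _ "{1..N}"]) (use assms in auto)
  have "S = prod.swap ` (SIGMA i:{1..p}. {k. (k, i) \<in> S})"
    using assms by force
  then have "card S = card (SIGMA i:{1..p}. {k. (k, i) \<in> S})"
    by (metis card_image inj_swap inj_on_subset subset_UNIV)
  also have "\<dots> = (\<Sum>i\<in>{1..p}. card {k. (k, i) \<in> S})"
    using fin by (simp add: card_SigmaI)
  also have "\<dots> = sum_list (map (\<lambda>i. card {k. (k, i) \<in> S}) [1..<p + 1])"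
    by (subst sum_list_distinct_conv_sum_set) (auto intro: sum.cong)
  finally show ?thesis
    by (simp add: coorbit_embedding_def length_concat comp_def del: upt_Suc)
qed

context finite_unitary_action
begin

lemma group_G: "group G"
  using group_hom by (rule group_hom.axioms(1))

lemma inner_shift:
  assumes "g \<in> carrier G" "h \<in> carrier G"
  shows "U g w \<bullet> U h x = U (inv h \<otimes> g) w \<bullet> x"
proof -
  interpret group G by (rule group_G)
  have "U h (U (inv h \<otimes> g) w) = U g w"
    using assms by (simp add: composition_rule[symmetric] m_assoc[symmetric])
  moreover have "U h v \<bullet> U h x = v \<bullet> x" for v
    using isometry[OF assms(2)] by (simp add: orthogonal_transformation_def)
  ultimately show ?thesis by metis
qed

lemma bij_betw_left_mult:
  assumes "h \<in> carrier G"
  shows "bij_betw (\<lambda>g. h \<otimes> g) (carrier G) (carrier G)"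
proof -
  interpret group G by (rule group_G)
  show ?thesis
    by (rule bij_betwI[where g = "\<lambda>g. inv h \<otimes> g"]) (use assms in \<open>auto simp: m_assoc[symmetric]\<close>)
qed

lemma bij_betw_right_mult:
  assumes "h \<in> carrier G"
  shows "bij_betw (\<lambda>g. g \<otimes> h) (carrier G) (carrier G)"
proof -
  interpret group G by (rule group_G)
  show ?thesis
    by (rule bij_betwI[where g = "\<lambda>g. g \<otimes> inv h"]) (use assms in \<open>auto simp: m_assoc\<close>)
qed

lemma coorbit_invariant:
  assumes h: "h \<in> carrier G"
  shows "coorbit G U w j (U h x) = coorbit G U w j x"
proof -
  interpret group G by (rule group_G)
  have b: "bij_betw (\<lambda>g. inv h \<otimes> g) (carrier G) (carrier G)"
    using h by (intro bij_betw_left_mult) auto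
  have "{#U g w \<bullet> U h x. g \<in># mset_set (carrier G)#}
      = {#U (inv h \<otimes> g) w \<bullet> x. g \<in># mset_set (carrier G)#}"
    using h finite_carrier by (intro image_mset_cong) (simp add: inner_shift)
  also have "\<dots> = {#U g w \<bullet> x. g \<in># image_mset (\<lambda>g. inv h \<otimes> g) (mset_set (carrier G))#}"
    by (simp add: image_mset.compositionality comp_def)
  also have "image_mset (\<lambda>g. inv h \<otimes> g) (mset_set (carrier G)) = mset_set (carrier G)"
    using b by (simp add: image_mset_mset_set bij_betw_def)
  finally show ?thesis by (simp add: coorbit_def)
qed

lemma coorbit_quot_orbit:
  "coorbit_quot G U p w S (orbit G U x) = coorbit_embedding G U p w S x"
proof -
  have "coorbit_embedding G U p w S ` orbit G U x = {coorbit_embedding G U p w S x}"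
    using orbit_refl[of x]
    by (auto simp: orbit_def coorbit_embedding_def coorbit_invariant)
  then show ?thesis by (simp add: coorbit_quot_def)
qed

lemma orbit_dist_orbit:
  "orbit_dist G U (orbit G U x) (orbit G U y) = Min ((\<lambda>g. norm (x - U g y)) ` carrier G)"
proof -
  interpret group G by (rule group_G)
  let ?D = "\<lambda>x y. (\<lambda>g. norm (x - U g y)) ` carrier G"
  have eq: "?D (U h x) (U k y) = ?D x y" if h: "h \<in> carrier G" and k: "k \<in> carrier G" for h k
  proof -
    have shift: "norm (U h x - U g (U k y)) = norm (x - U (inv h \<otimes> (g \<otimes> k)) y)"
      if g: "g \<in> carrier G" for g
    proof -
      have "U g (U k y) = U h (U (inv h \<otimes> (g \<otimes> k)) y)"
        using g h k by (simp add: composition_rule[symmetric] m_assoc[symmetric])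
      then have "U h x - U g (U k y) = U h (x - U (inv h \<otimes> (g \<otimes> k)) y)"
        using isometry[OF h] by (simp add: orthogonal_transformation_def linear_diff)
      then show ?thesis
        using isometry[OF h] by (simp add: orthogonal_transformation)
    qed
    have "bij_betw ((\<lambda>g. inv h \<otimes> g) \<circ> (\<lambda>g. g \<otimes> k)) (carrier G) (carrier G)"
      using h k by (intro bij_betw_trans[OF bij_betw_right_mult bij_betw_left_mult]) auto
    then have im: "(\<lambda>g. inv h \<otimes> (g \<otimes> k)) ` carrier G = carrier G"
      by (simp add: bij_betw_def comp_def)
    have "?D (U h x) (U k y) = (\<lambda>g. norm (x - U (inv h \<otimes> (g \<otimes> k)) y)) ` carrier G"
      by (intro image_cong) (auto simp: shift)
    also have "\<dots> = (\<lambda>g. norm (x - U g y)) ` ((\<lambda>g. inv h \<otimes> (g \<otimes> k)) ` carrier G)"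
      by (simp add: image_image)
    finally show ?thesis by (simp only: im)
  qed
  have "(\<lambda>(x, y). Min (?D x y)) ` (orbit G U x \<times> orbit G U y) = {Min (?D x y)}"
  proof (intro equalityI subsetI)
    fix r assume "r \<in> (\<lambda>(x, y). Min (?D x y)) ` (orbit G U x \<times> orbit G U y)"
    then obtain h k where "h \<in> carrier G" "k \<in> carrier G" "r = Min (?D (U h x) (U k y))"
      by (auto simp: orbit_def)
    then show "r \<in> {Min (?D x y)}" by (simp only: eq singleton_iff)
  next
    fix r assume "r \<in> {Min (?D x y)}"
    then show "r \<in> (\<lambda>(x, y). Min (?D x y)) ` (orbit G U x \<times> orbit G U y)"
      using orbit_refl[of x] orbit_refl[of y] by (intro image_eqI[of _ _ "(x, y)"]) auto
  qed
  then show ?thesis by (simp add: orbit_dist_def)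
qed

end

end

theory Submission
  imports Defs
begin

text \<open>
  Ordering the group elements by the size of \<open>\<langle>U\<^sub>g w\<^sub>i, x\<rangle>\<close>, for every window \<open>w\<^sub>i\<close>, cuts the space into
  finitely many polyhedral cones; on each of them the embedding \<open>\<Phi>\<close> is linear, because every
  coordinate of \<open>\<Phi>\<close> picks the same group element throughout.

  For the lower bound, fix a cone \<open>C\<close> for \<open>x\<close> and a cone \<open>D\<close> for \<open>y\<close>. On the polyhedral cone
  \<open>C \<times> D\<close> the difference \<open>L (x, y) = \<Phi> x - \<Phi> y\<close> is linear, and a Hoffman type error bound
  (\<open>polyhedral_cone_error_bound\<close>) gives a point \<open>(u, v) \<in> C \<times> D\<close> with \<open>L (u, v) = 0\<close> whose distance
  from \<open>(x, y)\<close> is at most a constant times \<open>\<bar>L (x, y)\<bar>\<close>. Now \<open>\<Phi> u = \<Phi> v\<close>, so injectivity on the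
  quotient puts \<open>u\<close> and \<open>v\<close> in one orbit, and the triangle inequality bounds the distance of the
  orbits of \<open>x\<close> and \<open>y\<close> by \<open>\<bar>x - u\<bar> + \<bar>y - v\<bar>\<close>. As there are finitely many pairs of cones, one
  constant serves them all.

  The upper bound holds coordinatewise: sorting is nonexpansive in the maximum norm, by a
  pigeonhole argument (\<open>coorbit_diff_le\<close>).
\<close>

section \<open>An error bound for polyhedral cones\<close>

lemma uniform_positive_constant:
  fixes R :: "'q \<Rightarrow> real \<Rightarrow> bool"
  assumes "finite Q"
    and "\<And>q. q \<in> Q \<Longrightarrow> \<exists>c>0. R q c"
    and anti: "\<And>q c c'. R q c \<Longrightarrow> c' \<le> c \<Longrightarrow> R q c'"
  shows "\<exists>c>0. \<forall>q\<in>Q. R q c"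
  using assms(1,2)
proof (induction Q rule: finite_induct)
  case empty
  show ?case by (auto intro: exI[of _ 1])
next
  case (insert q Q)
  obtain c where c: "c > 0" "\<forall>q\<in>Q. R q c" using insert by auto
  obtain c' where c': "c' > 0" "R q c'" using insert.prems by blast
  have "\<forall>r\<in>insert q Q. R r (min c c')"
    using c c' anti by (metis insert_iff min.cobounded1 min.cobounded2)
  then show ?case using c c' by (intro exI[of _ "min c c'"]) auto
qed

text \<open>
  Write \<open>T\<close> for the cone cut out by the vectors in \<open>I\<close> and \<open>L\<close> for the linear map with components
  \<open>b k\<close>. A nonzero \<open>d \<in> T\<close> in the polar cone of \<open>T \<inter> ker L\<close> cannot lie in \<open>ker L\<close>, since it would
  satisfy \<open>\<langle>d, d\<rangle> \<le> 0\<close>. Compactness of the unit sphere makes this quantitative.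
\<close>

lemma polar_error_bound:
  fixes I :: "'v::euclidean_space set" and b :: "'k \<Rightarrow> 'v"
  assumes J: "finite J"
  shows "\<exists>c>0. \<forall>d. (\<forall>a\<in>I. 0 \<le> a \<bullet> d) \<longrightarrow>
           (\<forall>t. (\<forall>a\<in>I. 0 \<le> a \<bullet> t) \<longrightarrow> (\<forall>k\<in>J. b k \<bullet> t = 0) \<longrightarrow> d \<bullet> t \<le> 0) \<longrightarrow>
           c * norm d \<le> L2_set (\<lambda>k. b k \<bullet> d) J"
proof -
  define T where "T = {t. (\<forall>a\<in>I. 0 \<le> a \<bullet> t) \<and> (\<forall>k\<in>J. b k \<bullet> t = 0)}"
  define D where "D = {d. \<forall>a\<in>I. 0 \<le> a \<bullet> d} \<inter> {d. \<forall>t\<in>T. d \<bullet> t \<le> 0}"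
  define L where "L d = L2_set (\<lambda>k. b k \<bullet> d) J" for d
  have "D = (\<Inter>a\<in>I. {d. 0 \<le> a \<bullet> d}) \<inter> (\<Inter>t\<in>T. {d. d \<bullet> t \<le> 0})"
    by (auto simp: D_def)
  then have "closed D"
    by (simp only:) (intro closed_Int closed_INT ballI closed_Collect_le continuous_intros)
  then have comp: "compact (D \<inter> sphere 0 1)"
    by (intro closed_Int_compact) auto
  have cont: "continuous_on (D \<inter> sphere 0 1) L"
    unfolding L_def L2_set_def by (intro continuous_intros)
  have pos: "L d > 0" if "d \<in> D \<inter> sphere 0 1" for d
  proof (rule ccontr)
    assume "\<not> L d > 0"
    then have "L d = 0" using L2_set_nonneg[of "\<lambda>k. b k \<bullet> d" J] by (simp add: L_def)
    then have "\<forall>k\<in>J. b k \<bullet> d = 0" using J by (simp add: L_def L2_set_eq_0_iff)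
    then have "d \<in> T" using that by (simp add: T_def D_def)
    then have "d \<bullet> d \<le> 0" using that by (auto simp: D_def)
    then have "d = 0" by (metis inner_eq_zero_iff inner_ge_zero order_antisym)
    then show False using that by simp
  qed
  have "\<exists>c>0. \<forall>d\<in>D \<inter> sphere 0 1. c \<le> L d"
  proof (cases "D \<inter> sphere 0 1 = {}")
    case True
    then show ?thesis by (auto intro: exI[of _ 1])
  next
    case False
    then obtain e where "e \<in> D \<inter> sphere 0 1" "\<forall>d\<in>D \<inter> sphere 0 1. L e \<le> L d"
      using continuous_attains_inf[OF comp _ cont] by blast
    then show ?thesis using pos by blast
  qed
  then obtain c where c: "c > 0" "\<And>d. d \<in> D \<inter> sphere 0 1 \<Longrightarrow> c \<le> L d" by blast
  have "c * norm d \<le> L d" if d: "d \<in> D" for d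
  proof (cases "d = 0")
    case True
    then show ?thesis by (simp add: L_def L2_set_nonneg)
  next
    case False
    have "(1 / norm d) *\<^sub>R d \<in> D \<inter> sphere 0 1"
      using d False by (auto simp: D_def divide_nonpos_nonneg)
    from c(2)[OF this] have "c \<le> L2_set (\<lambda>k. (1 / norm d) * (b k \<bullet> d)) J"
      by (simp add: L_def)
    also have "\<dots> = L d / norm d"
      unfolding L_def by (subst L2_set_right_distrib[symmetric]) auto
    finally show ?thesis using False by (simp add: field_simps)
  qed
  then show ?thesis using c(1) by (intro exI[of _ c]) (auto simp: D_def T_def L_def)
qed

text \<open>
  A homogeneous form of Hoffman's lemma: on a polyhedral cone \<open>P\<close>, the size of \<open>L z\<close> controls the
  distance of \<open>z\<close> from \<open>P \<inter> ker L\<close>. Let \<open>u\<close> be the point of \<open>P \<inter> ker L\<close> nearest to \<open>z\<close>, and let \<open>I\<close>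
  collect the constraints active at \<open>u\<close>. Then \<open>z - u\<close> satisfies the constraints in \<open>I\<close>, and it is
  polar to every direction that stays in \<open>P \<inter> ker L\<close> for a short time, so the previous bound
  applies. Only finitely many sets \<open>I\<close> can occur.
\<close>

lemma polyhedral_cone_error_bound:
  fixes A :: "'v::euclidean_space set" and b :: "'k \<Rightarrow> 'v"
  assumes A: "finite A" and J: "finite J"
  shows "\<exists>c>0. \<forall>z. (\<forall>a\<in>A. 0 \<le> a \<bullet> z) \<longrightarrow>
           (\<exists>u. (\<forall>a\<in>A. 0 \<le> a \<bullet> u) \<and> (\<forall>k\<in>J. b k \<bullet> u = 0) \<and>
                c * norm (z - u) \<le> L2_set (\<lambda>k. b k \<bullet> z) J)"
proof -
  define R where "R I c \<longleftrightarrow> (\<forall>d. (\<forall>a\<in>I. 0 \<le> a \<bullet> d) \<longrightarrow>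
      (\<forall>t. (\<forall>a\<in>I. 0 \<le> a \<bullet> t) \<longrightarrow> (\<forall>k\<in>J. b k \<bullet> t = 0) \<longrightarrow> d \<bullet> t \<le> 0) \<longrightarrow>
      c * norm d \<le> L2_set (\<lambda>k. b k \<bullet> d) J)" for I c
  have "\<exists>c>0. \<forall>I\<in>Pow A. R I c"
  proof (rule uniform_positive_constant)
    show "\<exists>c>0. R I c" for I
      unfolding R_def by (rule polar_error_bound[OF J])
    show "R I c'" if "R I c" "c' \<le> c" for I c c'
      using that unfolding R_def by (blast intro: order_trans[OF mult_right_mono[OF _ norm_ge_zero]])
  qed (use A in simp)
  then obtain c where c: "c > 0" "\<And>I. I \<subseteq> A \<Longrightarrow> R I c" by blast
  define K where "K = {u. (\<forall>a\<in>A. 0 \<le> a \<bullet> u) \<and> (\<forall>k\<in>J. b k \<bullet> u = 0)}"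
  have "K = (\<Inter>a\<in>A. {u. 0 \<le> a \<bullet> u}) \<inter> (\<Inter>k\<in>J. {u. b k \<bullet> u = 0})"
    by (auto simp: K_def)
  then have "closed K"
    by (simp only:) (intro closed_Int closed_INT ballI closed_Collect_le closed_Collect_eq continuous_intros)
  moreover have "convex K"
    by (simp add: convex_def K_def inner_add_right)
  ultimately have K: "closed K" "convex K" by blast+
  have "0 \<in> K" by (simp add: K_def)
  have "\<exists>u\<in>K. c * norm (z - u) \<le> L2_set (\<lambda>k. b k \<bullet> z) J" if z: "\<forall>a\<in>A. 0 \<le> a \<bullet> z" for z
  proof -
    define u where "u = closest_point K z"
    have u: "u \<in> K" unfolding u_def using K \<open>0 \<in> K\<close> by (intro closest_point_in_set) auto
    define I where "I = {a\<in>A. a \<bullet> u = 0}"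
    have "(z - u) \<bullet> t \<le> 0" if tI: "\<forall>a\<in>I. 0 \<le> a \<bullet> t" and tJ: "\<forall>k\<in>J. b k \<bullet> t = 0" for t
    proof -
      \<comment> \<open>A short step from \<open>u\<close> along \<open>t\<close> stays in \<open>K\<close>: active constraints are respected by \<open>t\<close>,
        inactive ones hold strictly at \<open>u\<close>.\<close>
      have "\<forall>\<^sub>F e in at_right 0. \<forall>a\<in>A. 0 \<le> a \<bullet> u + e * (a \<bullet> t)"
      proof (rule eventually_ball_finite[OF A], rule ballI)
        fix a assume a: "a \<in> A"
        show "\<forall>\<^sub>F e in at_right 0. 0 \<le> a \<bullet> u + e * (a \<bullet> t)"
        proof (cases "a \<in> I")
          case True
          then show ?thesis
            using tI eventually_at_right_less[of "0::real"]
            by (auto simp: I_def elim!: eventually_mono)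
        next
          case False
          then have "0 < a \<bullet> u" using a u by (auto simp: I_def K_def order_less_le)
          moreover have "((\<lambda>e. a \<bullet> u + e * (a \<bullet> t)) \<longlongrightarrow> a \<bullet> u + 0 * (a \<bullet> t)) (at_right 0)"
            by (intro tendsto_intros)
          ultimately show ?thesis
            by (auto dest!: order_tendstoD(1)[where a = 0] elim!: eventually_mono)
        qed
      qed
      then have "\<forall>\<^sub>F e in at_right 0. (0::real) < e \<and> (\<forall>a\<in>A. 0 \<le> a \<bullet> u + e * (a \<bullet> t))"
        using eventually_at_right_less[of "0::real"] by (rule eventually_conj[rotated])
      then obtain e :: real where e: "e > 0" "\<forall>a\<in>A. 0 \<le> a \<bullet> u + e * (a \<bullet> t)"
        using eventually_happens'[OF trivial_limit_at_right_real] by blast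
      then have "u + e *\<^sub>R t \<in> K"
        using u tJ by (simp add: K_def inner_add_right)
      then have "(z - u) \<bullet> (u + e *\<^sub>R t - u) \<le> 0"
        unfolding u_def using K by (intro closest_point_dot)
      then show ?thesis using e by (simp add: mult_le_0_iff)
    qed
    moreover have "\<forall>a\<in>I. 0 \<le> a \<bullet> (z - u)"
      using z by (simp add: I_def inner_diff_right)
    ultimately have "c * norm (z - u) \<le> L2_set (\<lambda>k. b k \<bullet> (z - u)) J"
      using c(2)[of I] by (simp add: R_def I_def)
    also have "\<dots> = L2_set (\<lambda>k. b k \<bullet> z) J"
      using u by (intro L2_set_cong) (auto simp: K_def inner_diff_right)
    finally show ?thesis using u by blast
  qed
  then show ?thesis using c(1) by (intro exI[of _ c]) (auto simp: K_def)
qed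

section \<open>Cones of linearity\<close>

context finite_unitary_action
begin

definition enumerations :: "'g list set" where
  "enumerations = {gs. distinct gs \<and> set gs = carrier G}"

definition descending :: "'a \<Rightarrow> 'a \<Rightarrow> 'g list \<Rightarrow> bool" where
  "descending w x gs \<longleftrightarrow> sorted_wrt (\<lambda>g h. U h w \<bullet> x \<le> U g w \<bullet> x) gs"

lemma finite_enumerations: "finite enumerations"
  using finite_carrier
  by (rule finite_subset[rotated, OF finite_subset_distinct]) (auto simp: enumerations_def)

lemma length_enumeration: "gs \<in> enumerations \<Longrightarrow> length gs = card (carrier G)"
  by (auto simp: enumerations_def dest: distinct_card)

lemma ex_descending: "\<exists>gs\<in>enumerations. descending w x gs"
proof -
  obtain xs where xs: "set xs = carrier G" "distinct xs"
    using finite_distinct_list[OF finite_carrier] by blast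
  let ?gs = "sort_key (\<lambda>g. - (U g w \<bullet> x)) xs"
  have "sorted (map (\<lambda>g. - (U g w \<bullet> x)) ?gs)" by simp
  then have "descending w x ?gs" by (simp add: descending_def sorted_wrt_map)
  then show ?thesis using xs by (intro bexI[of _ ?gs]) (auto simp: enumerations_def)
qed

text \<open>
  The linearity of \<open>\<Phi>\<close> on its cones: the right-hand side is linear in \<open>x\<close> as long as \<open>gs\<close> is fixed.
  The shift of the index is due to lists being counted from \<open>0\<close>.
\<close>

lemma coorbit_descending:
  assumes gs: "gs \<in> enumerations" "descending w x gs" and j: "j \<in> {1..card (carrier G)}"
  shows "coorbit G U w j x = U (gs ! (j - 1)) w \<bullet> x"
proof -
  let ?xs = "map (\<lambda>g. U g w \<bullet> x) gs"
  have "mset_set (carrier G) = mset gs"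
    using gs(1) mset_set_set[of gs] by (simp add: enumerations_def)
  then have "{#U g w \<bullet> x. g \<in># mset_set (carrier G)#} = mset (rev ?xs)" by simp
  moreover have "sorted (rev ?xs)"
    using gs(2) by (simp add: descending_def sorted_wrt_rev sorted_wrt_map)
  ultimately have "sorted_list_of_multiset {#U g w \<bullet> x. g \<in># mset_set (carrier G)#} = rev ?xs"
    by (simp only: sorted_list_of_multiset_mset sorted_sort_id)
  then show ?thesis
    using j length_enumeration[OF gs(1)] by (auto simp: coorbit_def intro!: nth_map)
qed

lemma descending_polyhedral:
  assumes "finite I"
  shows "\<exists>A. finite A \<and> (\<forall>x. (\<forall>i\<in>I. descending (w i) x (s i)) \<longleftrightarrow> (\<forall>a\<in>A. 0 \<le> a \<bullet> x))"
proof -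
  define A where "A = (\<Union>i\<in>I. (\<lambda>(k, l). U (s i ! k) (w i) - U (s i ! l) (w i)) `
                        {(k, l). k < l \<and> l < length (s i)})"
  have "finite {(k, l). k < l \<and> l < n}" for n :: nat
    by (rule finite_subset[of _ "{..<n} \<times> {..<n}"]) auto
  then have "finite A" unfolding A_def using assms by blast
  moreover have "(\<forall>i\<in>I. descending (w i) x (s i)) \<longleftrightarrow> (\<forall>a\<in>A. 0 \<le> a \<bullet> x)" for x
    unfolding A_def descending_def sorted_wrt_iff_nth_less
    by (auto simp: inner_diff_left)
  ultimately show ?thesis by blast
qed

section \<open>The upper bound\<close>

text \<open>
  The \<open>j\<close> group elements with the largest values at \<open>x\<close> and the \<open>N - j + 1\<close> group elements with the
  smallest values at \<open>y\<close> have a common member \<open>g\<close>, and for it \<open>\<langle>U\<^sub>g w, x\<rangle>\<close> is at least the sorted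
  entry at \<open>x\<close>, while \<open>\<langle>U\<^sub>g w, y\<rangle>\<close> is at most the sorted entry at \<open>y\<close>.
\<close>

lemma coorbit_diff_le:
  assumes j: "j \<in> {1..card (carrier G)}"
  shows "coorbit G U w j x - coorbit G U w j y \<le> norm w * norm (x - y)"
proof -
  obtain s where s: "s \<in> enumerations" "descending w x s" using ex_descending by blast
  obtain t where t: "t \<in> enumerations" "descending w y t" using ex_descending by blast
  note len = length_enumeration[OF s(1)] length_enumeration[OF t(1)]
  have "set (take j s) \<inter> set (drop (j - 1) t) \<noteq> {}"
  proof
    assume disj: "set (take j s) \<inter> set (drop (j - 1) t) = {}"
    have "card (set (take j s)) + card (set (drop (j - 1) t))
        = card (set (take j s) \<union> set (drop (j - 1) t))"
      using disj by (intro card_Un_disjoint[symmetric]) auto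
    also have "\<dots> \<le> card (carrier G)"
      using s(1) t(1)
      by (intro card_mono finite_carrier) (auto simp: enumerations_def dest: in_set_takeD in_set_dropD)
    finally show False
      using s(1) t(1) j len by (simp add: enumerations_def distinct_card)
  qed
  then obtain g where g: "g \<in> set (take j s)" "g \<in> set (drop (j - 1) t)" by blast
  obtain k where k: "k < j" "k < length s" "g = s ! k"
    using g(1) by (auto simp: in_set_conv_nth)
  obtain l where l: "l \<ge> j - 1" "l < length t" "g = t ! l"
  proof -
    obtain i where "i < length (drop (j - 1) t)" "drop (j - 1) t ! i = g"
      using g(2) unfolding in_set_conv_nth by blast
    then show ?thesis using that[of "j - 1 + i"] by simp
  qed
  have "U (s ! (j - 1)) w \<bullet> x \<le> U g w \<bullet> x"
    using s(2) k j len unfolding descending_def sorted_wrt_iff_nth_less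
    by (cases "k = j - 1") auto
  moreover have "U g w \<bullet> y \<le> U (t ! (j - 1)) w \<bullet> y"
    using t(2) l j len unfolding descending_def sorted_wrt_iff_nth_less
    by (cases "l = j - 1") auto
  ultimately have "coorbit G U w j x - coorbit G U w j y \<le> U g w \<bullet> (x - y)"
    using coorbit_descending[OF s j] coorbit_descending[OF t j] by (simp add: inner_diff_right)
  also have "\<dots> \<le> norm (U g w) * norm (x - y)"
    by (rule norm_cauchy_schwarz)
  also have "norm (U g w) = norm w"
  proof -
    have "g \<in> carrier G" using in_set_takeD[OF g(1)] s(1) by (simp add: enumerations_def)
    then show ?thesis using isometry[of g] by (simp add: orthogonal_transformation)
  qed
  finally show ?thesis .
qed

lemma coorbit_lipschitz:
  assumes "j \<in> {1..card (carrier G)}"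
  shows "\<bar>coorbit G U w j x - coorbit G U w j y\<bar> \<le> norm w * norm (x - y)"
  using coorbit_diff_le[OF assms, of w x y] coorbit_diff_le[OF assms, of w y x]
  by (simp add: norm_minus_commute abs_le_iff)

section \<open>The embedding as a list of coordinates\<close>

definition coordinates :: "nat \<Rightarrow> (nat \<times> nat) set \<Rightarrow> (nat \<times> nat) list" where
  "coordinates p S =
     concat (map (\<lambda>i. map (\<lambda>j. (i, j)) (sorted_list_of_set {k. (k, i) \<in> S})) [1..<p + 1])"

lemma coorbit_embedding_coordinates:
  "coorbit_embedding G U p w S x = map (\<lambda>(i, j). coorbit G U (w i) j x) (coordinates p S)"
  by (simp add: coorbit_embedding_def coordinates_def map_concat comp_def)

lemma set_coordinates_subset:
  assumes "S \<subseteq> {1..N} \<times> {1..p}"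
  shows "set (coordinates p S) \<subseteq> {1..p} \<times> {1..N}"
proof -
  have "finite {k. (k, i) \<in> S}" for i
    by (rule finite_subset[of _ "{1..N}"]) (use assms in auto)
  then show ?thesis using assms by (auto simp: coordinates_def)
qed

lemma orbit_dist_le:
  assumes "g \<in> carrier G"
  shows "orbit_dist G U (orbit G U x) (orbit G U y) \<le> norm (x - U g y)"
  unfolding orbit_dist_orbit using assms finite_carrier by (intro Min_le) auto

lemma orbit_dist_attained:
  "\<exists>g\<in>carrier G. orbit_dist G U (orbit G U x) (orbit G U y) = norm (x - U g y)"
proof -
  have "carrier G \<noteq> {}" using group.is_monoid[OF group_G] monoid.one_closed by blast
  then have "Min ((\<lambda>g. norm (x - U g y)) ` carrier G) \<in> (\<lambda>g. norm (x - U g y)) ` carrier G"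
    using finite_carrier by (intro Min_in) auto
  then show ?thesis unfolding orbit_dist_orbit by blast
qed

lemma orbit_dist_le_via_orbit:
  assumes "orbit G U u = orbit G U v"
  shows "orbit_dist G U (orbit G U x) (orbit G U y) \<le> norm (x - u) + norm (y - v)"
proof -
  have "u \<in> orbit G U v" using assms orbit_refl[of u] by simp
  then obtain g where g: "g \<in> carrier G" "u = U g v" by (auto simp: orbit_def)
  have "U g v - U g y = U g (v - y)"
    using isometry[OF g(1)] by (simp add: orthogonal_transformation_def linear_diff)
  then have "norm (u - U g y) = norm (y - v)"
    using isometry[OF g(1)] g(2) by (simp add: orthogonal_transformation norm_minus_commute)
  moreover have "norm (x - U g y) \<le> norm (x - u) + norm (u - U g y)"
    by (metis diff_add_cancel add_diff_eq norm_triangle_ineq)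
  ultimately show ?thesis using orbit_dist_le[OF g(1), of x y] by linarith
qed

lemma coorbit_embedding_upper_lipschitz:
  assumes "S \<subseteq> {1..card (carrier G)} \<times> {1..p}" and m: "card S = m"
  shows "\<exists>b. \<forall>x y.
    L2_set (\<lambda>k. coorbit_embedding G U p w S x ! k - coorbit_embedding G U p w S y ! k) {..<m}
      \<le> b * orbit_dist G U (orbit G U x) (orbit G U y)"
proof (intro exI allI)
  fix x y
  let ?c = "coordinates p S"
  let ?F = "coorbit_embedding G U p w S"
  have len: "length ?c = m"
    using length_coorbit_embedding[OF assms(1), of G U w x] m
    by (simp add: coorbit_embedding_coordinates)
  obtain g where g: "g \<in> carrier G" "orbit_dist G U (orbit G U x) (orbit G U y) = norm (x - U g y)"
    using orbit_dist_attained by blast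
  have inv: "?F (U g y) = ?F y"
    by (simp add: coorbit_embedding_def coorbit_invariant[OF g(1)])
  have "L2_set (\<lambda>k. ?F x ! k - ?F y ! k) {..<m} \<le> (\<Sum>k<m. \<bar>?F x ! k - ?F (U g y) ! k\<bar>)"
    unfolding inv by (rule L2_set_le_sum_abs)
  also have "\<dots> \<le> (\<Sum>k<m. norm (w (fst (?c ! k))) * norm (x - U g y))"
  proof (rule sum_mono)
    fix k assume "k \<in> {..<m}"
    then have k: "k < length ?c" using len by simp
    then have "?c ! k \<in> {1..p} \<times> {1..card (carrier G)}"
      using set_coordinates_subset[OF assms(1)] nth_mem by blast
    then show "\<bar>?F x ! k - ?F (U g y) ! k\<bar> \<le> norm (w (fst (?c ! k))) * norm (x - U g y)"
      using k by (auto simp: coorbit_embedding_coordinates split_beta intro!: coorbit_lipschitz)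
  qed
  also have "\<dots> = (\<Sum>k<m. norm (w (fst (?c ! k)))) * orbit_dist G U (orbit G U x) (orbit G U y)"
    by (simp add: g(2) sum_distrib_right)
  finally show "L2_set (\<lambda>k. ?F x ! k - ?F y ! k) {..<m}
    \<le> (\<Sum>k<m. norm (w (fst (?c ! k)))) * orbit_dist G U (orbit G U x) (orbit G U y)" .
qed

section \<open>The lower bound\<close>

text \<open>
  On a product of two cones of linearity, the error bound is applied to the map
  \<open>(x, y) \<mapsto> \<Phi> x - \<Phi> y\<close>, whose zeros are pairs of points in the same orbit.
\<close>

lemma lower_lipschitz_on_cones:
  assumes S: "S \<subseteq> {1..card (carrier G)} \<times> {1..p}" and m: "card S = m"
    and inj: "inj_on (coorbit_quot G U p w S) (orbits G UNIV U)"
    and s: "s \<in> {1..p} \<rightarrow> enumerations" and t: "t \<in> {1..p} \<rightarrow> enumerations"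
  shows "\<exists>a>0. \<forall>x y. (\<forall>i\<in>{1..p}. descending (w i) x (s i)) \<longrightarrow>
    (\<forall>i\<in>{1..p}. descending (w i) y (t i)) \<longrightarrow>
    a * orbit_dist G U (orbit G U x) (orbit G U y)
      \<le> L2_set (\<lambda>k. coorbit_embedding G U p w S x ! k - coorbit_embedding G U p w S y ! k) {..<m}"
proof -
  let ?c = "coordinates p S"
  let ?F = "coorbit_embedding G U p w S"
  have len: "length ?c = m"
    using length_coorbit_embedding[OF S, of G U w undefined] m
    by (simp add: coorbit_embedding_coordinates)
  \<comment> \<open>The vector representing the \<open>k\<close>-th coordinate on the cone that belongs to the enumerations \<open>r\<close>.\<close>
  define pick where
    "pick r k = U (r (fst (?c ! k)) ! (snd (?c ! k) - 1)) (w (fst (?c ! k)))" for r k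
  have F_linear: "?F x ! k = pick r k \<bullet> x"
    if "k < m" "r \<in> {1..p} \<rightarrow> enumerations" "\<forall>i\<in>{1..p}. descending (w i) x (r i)" for x r k
  proof -
    have "?c ! k \<in> {1..p} \<times> {1..card (carrier G)}"
      using set_coordinates_subset[OF S] nth_mem len that(1) by blast
    then have mem: "fst (?c ! k) \<in> {1..p}" "snd (?c ! k) \<in> {1..card (carrier G)}"
      by (simp_all add: mem_Times_iff)
    have "r (fst (?c ! k)) \<in> enumerations" using that(2) mem(1) by blast
    moreover have "descending (w (fst (?c ! k))) x (r (fst (?c ! k)))" using that(3) mem(1) by blast
    ultimately have "coorbit G U (w (fst (?c ! k))) (snd (?c ! k)) x = pick r k \<bullet> x"
      unfolding pick_def using mem(2) by (rule coorbit_descending)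
    then show ?thesis using that(1) len by (simp add: coorbit_embedding_coordinates split_beta)
  qed
  obtain A1 where A1: "finite A1"
      "\<And>x. (\<forall>i\<in>{1..p}. descending (w i) x (s i)) \<longleftrightarrow> (\<forall>a\<in>A1. 0 \<le> a \<bullet> x)"
    using descending_polyhedral[of "{1..p}" w s] by auto
  obtain A2 where A2: "finite A2"
      "\<And>x. (\<forall>i\<in>{1..p}. descending (w i) x (t i)) \<longleftrightarrow> (\<forall>a\<in>A2. 0 \<le> a \<bullet> x)"
    using descending_polyhedral[of "{1..p}" w t] by auto
  define A where "A = (\<lambda>a. (a, 0)) ` A1 \<union> (\<lambda>a. (0, a)) ` A2"
  have A: "(\<forall>a\<in>A. 0 \<le> a \<bullet> (x, y)) \<longleftrightarrow>
      (\<forall>i\<in>{1..p}. descending (w i) x (s i)) \<and> (\<forall>i\<in>{1..p}. descending (w i) y (t i))" for x y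
    unfolding A1(2) A2(2) by (auto simp: A_def ball_Un)
  have "finite A" using A1(1) A2(1) by (simp add: A_def)
  define b where "b k = (pick s k, - pick t k)" for k
  have b: "b k \<bullet> (x, y) = ?F x ! k - ?F y ! k"
    if "k < m" "\<forall>a\<in>A. 0 \<le> a \<bullet> (x, y)" for k x y
    using that F_linear[OF that(1) s, of x] F_linear[OF that(1) t, of y] by (simp add: A b_def)
  obtain c where c: "c > 0"
    and bound: "\<And>z. \<forall>a\<in>A. 0 \<le> a \<bullet> z \<Longrightarrow> \<exists>u. (\<forall>a\<in>A. 0 \<le> a \<bullet> u) \<and> (\<forall>k<m. b k \<bullet> u = 0) \<and>
                c * norm (z - u) \<le> L2_set (\<lambda>k. b k \<bullet> z) {..<m}"
    using polyhedral_cone_error_bound[OF \<open>finite A\<close>, of "{..<m}" b] by (auto simp: Ball_def)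
  have "c / 2 * orbit_dist G U (orbit G U x) (orbit G U y)
          \<le> L2_set (\<lambda>k. ?F x ! k - ?F y ! k) {..<m}"
    if xy: "\<forall>a\<in>A. 0 \<le> a \<bullet> (x, y)" for x y
  proof -
    obtain u v where uv: "\<forall>a\<in>A. 0 \<le> a \<bullet> (u, v)" "\<forall>k<m. b k \<bullet> (u, v) = 0"
        "c * norm ((x, y) - (u, v)) \<le> L2_set (\<lambda>k. b k \<bullet> (x, y)) {..<m}"
      using bound[OF xy] by (metis surj_pair)
    have "?F u = ?F v"
    proof (rule nth_equalityI)
      show "length (?F u) = length (?F v)" by (simp add: coorbit_embedding_coordinates)
      show "?F u ! k = ?F v ! k" if "k < length (?F u)" for k
      proof -
        have "k < m" using that len by (simp add: coorbit_embedding_coordinates)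
        then show ?thesis using b[OF _ uv(1)] uv(2) by (metis eq_iff_diff_eq_0)
      qed
    qed
    then have "coorbit_quot G U p w S (orbit G U u) = coorbit_quot G U p w S (orbit G U v)"
      by (simp add: coorbit_quot_orbit)
    then have "orbit G U u = orbit G U v"
      by (rule inj_onD[OF inj]) (auto simp: orbits_def)
    then have "orbit_dist G U (orbit G U x) (orbit G U y) \<le> norm (x - u) + norm (y - v)"
      by (rule orbit_dist_le_via_orbit)
    also have "\<dots> \<le> 2 * norm ((x, y) - (u, v))"
      using norm_fst_le[of "x - u" "y - v"] norm_snd_le[of "y - v" "x - u"] by simp
    finally have "c / 2 * orbit_dist G U (orbit G U x) (orbit G U y)
        \<le> c / 2 * (2 * norm ((x, y) - (u, v)))"
      using c by (intro mult_left_mono) auto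
    also have "\<dots> \<le> L2_set (\<lambda>k. b k \<bullet> (x, y)) {..<m}"
      using uv(3) by simp
    also have "\<dots> = L2_set (\<lambda>k. ?F x ! k - ?F y ! k) {..<m}"
      by (intro L2_set_cong) (auto simp: b[OF _ xy])
    finally show ?thesis .
  qed
  then show ?thesis using c A by (intro exI[of _ "c / 2"]) auto
qed

lemma coorbit_embedding_lower_lipschitz:
  assumes S: "S \<subseteq> {1..card (carrier G)} \<times> {1..p}" and m: "card S = m"
    and inj: "inj_on (coorbit_quot G U p w S) (orbits G UNIV U)"
  shows "\<exists>a>0. \<forall>x y. a * orbit_dist G U (orbit G U x) (orbit G U y)
      \<le> L2_set (\<lambda>k. coorbit_embedding G U p w S x ! k - coorbit_embedding G U p w S y ! k) {..<m}"
proof -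
  let ?F = "coorbit_embedding G U p w S"
  let ?d = "\<lambda>x y. orbit_dist G U (orbit G U x) (orbit G U y)"
  let ?L = "\<lambda>x y. L2_set (\<lambda>k. ?F x ! k - ?F y ! k) {..<m}"
  let ?E = "{1..p} \<rightarrow>\<^sub>E enumerations"
  define R where "R q a \<longleftrightarrow> (\<forall>x y. (\<forall>i\<in>{1..p}. descending (w i) x (fst q i)) \<longrightarrow>
    (\<forall>i\<in>{1..p}. descending (w i) y (snd q i)) \<longrightarrow> a * ?d x y \<le> ?L x y)"
    for q :: "(nat \<Rightarrow> 'g list) \<times> (nat \<Rightarrow> 'g list)" and a
  have d_nonneg: "0 \<le> ?d x y" for x y
    using orbit_dist_attained[of x y] by auto
  have "\<exists>a>0. \<forall>q\<in>?E \<times> ?E. R q a"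
  proof (rule uniform_positive_constant)
    show "finite (?E \<times> ?E)" by (intro finite_cartesian_product finite_PiE finite_enumerations) auto
    show "\<exists>a>0. R q a" if "q \<in> ?E \<times> ?E" for q
      unfolding R_def by (rule lower_lipschitz_on_cones[OF S m inj]) (use that in auto)
    show "R q a'" if "R q a" "a' \<le> a" for q a a'
      using that d_nonneg unfolding R_def by (meson mult_right_mono order_trans)
  qed
  then obtain a where a: "a > 0" "\<And>q. q \<in> ?E \<times> ?E \<Longrightarrow> R q a" by blast
  have E: "\<exists>s\<in>?E. \<forall>i\<in>{1..p}. descending (w i) x (s i)" for x
  proof -
    have "\<forall>i. \<exists>gs. gs \<in> enumerations \<and> descending (w i) x gs"
      using ex_descending by blast
    then obtain s where s: "\<And>i. s i \<in> enumerations \<and> descending (w i) x (s i)"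
      by metis
    then show ?thesis by (intro bexI[of _ "restrict s {1..p}"]) auto
  qed
  have "a * ?d x y \<le> ?L x y" for x y
  proof -
    obtain s t where "s \<in> ?E" "\<forall>i\<in>{1..p}. descending (w i) x (s i)"
        "t \<in> ?E" "\<forall>i\<in>{1..p}. descending (w i) y (t i)"
      using E[of x] E[of y] by blast
    then show ?thesis using a(2)[of "(s, t)"] by (auto simp: R_def)
  qed
  then show ?thesis using a(1) by blast
qed

end

section \<open>Injective coorbit embeddings are bi-Lipschitz\<close>

theorem theorem1p4:
  fixes G :: "('g, 'b) monoid_scheme"
    and U :: "'g \<Rightarrow> 'a::euclidean_space \<Rightarrow> 'a"
    and N p m :: nat
    and w :: "nat \<Rightarrow> 'a"
    and S :: "(nat \<times> nat) set"
  assumes "DIM('a) \<ge> 2"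
    and "finite_unitary_action G U"
    and "card (carrier G) = N"
    and "S \<subseteq> {1..N} \<times> {1..p}"
    and "card S = m"
    and "inj_on (coorbit_quot G U p w S) (orbits G UNIV U)"
  shows "\<exists>a b :: real. 0 < a \<and> a \<le> b \<and>
    (\<forall>x y :: 'a.
       a * orbit_dist G U (orbit G U x) (orbit G U y)
         \<le> L2_set (\<lambda>k. coorbit_embedding G U p w S x ! k - coorbit_embedding G U p w S y ! k) {..<m}
     \<and> L2_set (\<lambda>k. coorbit_embedding G U p w S x ! k - coorbit_embedding G U p w S y ! k) {..<m}
         \<le> b * orbit_dist G U (orbit G U x) (orbit G U y))"
proof -
  interpret finite_unitary_action G U by (rule assms(2))
  let ?F = "coorbit_embedding G U p w S"
  let ?d = "\<lambda>x y. orbit_dist G U (orbit G U x) (orbit G U y)"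
  let ?L = "\<lambda>x y. L2_set (\<lambda>k. ?F x ! k - ?F y ! k) {..<m}"
  have S: "S \<subseteq> {1..card (carrier G)} \<times> {1..p}" using assms(3,4) by simp
  obtain a where a: "a > 0" "\<And>x y. a * ?d x y \<le> ?L x y"
    using coorbit_embedding_lower_lipschitz[OF S assms(5,6)] by blast
  obtain b where b: "\<And>x y. ?L x y \<le> b * ?d x y"
    using coorbit_embedding_upper_lipschitz[OF S assms(5)] by blast
  have "?L x y \<le> max a b * ?d x y" for x y
  proof -
    have "0 \<le> ?d x y" using orbit_dist_attained[of x y] by auto
    then have "b * ?d x y \<le> max a b * ?d x y" by (intro mult_right_mono) auto
    then show ?thesis using b[of x y] by linarith
  qed
  then show ?thesis using a by (intro exI[of _ a] exI[of _ "max a b"]) auto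
qed

end
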